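(* Let $\mathcal{S}\subseteq\{0,1\}^n$ be a set of vectors such that for every $i\in[n]$ there exist $v,w\in\mathcal{S}$ with $v_i=1$ and $w_i=0$. A vector $v\in\{0,1\}^n$ belongs to $Cl_{S_{12}}(\mathcal{S})$ if and only if (1) there exists $w\in\mathcal{S}$ with $\mathbb{1}(v)\subseteq\mathbb{1}(w)$, and (2) for all $(k,i)\in\mathbb{1}(v)\times\mathbb{0}(v)$ there exists $w\in\mathcal{S}$ with $(w_k,w_i)=(0,1)$ or $(w_k,w_i)=(1,0)$.
   Context: For $v\in\{0,1\}^n$, $\mathbb{1}(v)=\{i\mid v_i=1\}$ and $\mathbb{0}(v)=\{i\mid v_i=0\}$. Boolean operations act on vectors coordinate-wise. $S_{12}$ is the clone generated by the ternary operation $x\wedge(y\to z)$, and $Cl_{S_{12}}(\mathcal{S})$ is the smallest set of vectors containing $\mathcal{S}$ and closed under $(x,y,z)\mapsto x\wedge(y\to z)$ (applied coordinate-wise). *)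

theory Defs
  imports Main "HOL-Library.FuncSet"
begin

text \<open>Vectors in \<open>{0,1}\<^sup>n\<close> are extensional functions on \<open>{1..n}\<close>, with \<open>True\<close> for 1 and \<open>False\<close> for 0.\<close>

definition bvecs :: "nat \<Rightarrow> (nat \<Rightarrow> bool) set" where
  "bvecs n = {1..n} \<rightarrow>\<^sub>E UNIV"

definition ones :: "nat \<Rightarrow> (nat \<Rightarrow> bool) \<Rightarrow> nat set" where
  "ones n v = {i \<in> {1..n}. v i = True}"

definition zeros :: "nat \<Rightarrow> (nat \<Rightarrow> bool) \<Rightarrow> nat set" where
  "zeros n v = {i \<in> {1..n}. v i = False}"

definition s12_op :: "bool \<Rightarrow> bool \<Rightarrow> bool \<Rightarrow> bool" where
  "s12_op x y z \<longleftrightarrow> x \<and> (y \<longrightarrow> z)"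

inductive_set Cl_S12 :: "nat \<Rightarrow> (nat \<Rightarrow> bool) set \<Rightarrow> (nat \<Rightarrow> bool) set"
  for n :: nat and S :: "(nat \<Rightarrow> bool) set" where
  base: "v \<in> S \<Longrightarrow> v \<in> Cl_S12 n S"
| step: "\<lbrakk>x \<in> Cl_S12 n S; y \<in> Cl_S12 n S; z \<in> Cl_S12 n S\<rbrakk>
    \<Longrightarrow> (\<lambda>i\<in>{1..n}. s12_op (x i) (y i) (z i)) \<in> Cl_S12 n S"

end

theory Submission
  imports Defs
begin

text \<open>
  Both conditions are inherited by \<open>x \<and> (y \<longrightarrow> z)\<close>: it lies below \<open>x\<close>, and two coordinates on
  which all of \<open>S\<close> agree stay equal.  Conversely, the closure is closed under meets, since
  \<open>x \<and> z = x \<and> (x \<longrightarrow> z)\<close>; hence it contains the zero vector and is closed under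
  \<open>x \<and> \<not> y = x \<and> (y \<longrightarrow> 0)\<close>.  Separating a zero \<open>i\<close> of \<open>v\<close> from each one \<open>k\<close> of \<open>v\<close> and
  taking meets yields \<open>y\<close> in the closure with \<open>y i = 1\<close> and \<open>y = 0\<close> on the ones of \<open>v\<close>.
  Removing all these \<open>y\<close> from a member of \<open>S\<close> above \<open>v\<close> leaves exactly \<open>v\<close>.
\<close>

text \<open>The operation lies below its first argument, so the witness for \<open>x\<close> serves
  again in the induction step.\<close>

lemma Cl_S12_below:
  assumes "x \<in> Cl_S12 n S"
  shows "\<exists>w\<in>S. \<forall>i\<in>{1..n}. x i \<longrightarrow> w i"
  using assms
proof induction
  case (base v)
  then show ?case by blast
next
  case (step x y z)
  then show ?case by (auto simp: s12_op_def)
qed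

lemma Cl_S12_separates:
  assumes "x \<in> Cl_S12 n S" and "k \<in> {1..n}" and "i \<in> {1..n}" and "x k \<noteq> x i"
  shows "\<exists>w\<in>S. w k \<noteq> w i"
  using assms
proof induction
  case (base v)
  then show ?case by blast
next
  case (step x y z)
  \<comment> \<open>Arguments that all agree at \<open>k\<close> and \<open>i\<close> would give
    equal values there, so one of them already tells the two coordinates apart.\<close>
  have "x k \<noteq> x i \<or> y k \<noteq> y i \<or> z k \<noteq> z i"
    using step.prems by (auto simp: s12_op_def)
  with step show ?case by blast
qed

text \<open>The leading \<open>x\<close> replaces the empty meet, the all-ones vector, which may lie
  outside the closure.\<close>

lemma Cl_S12_meet:
  assumes "finite F" and "x \<in> Cl_S12 n S" and "\<And>j. j \<in> F \<Longrightarrow> g j \<in> Cl_S12 n S"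
  shows "(\<lambda>i\<in>{1..n}. x i \<and> (\<forall>j\<in>F. g j i)) \<in> Cl_S12 n S"
  using assms(1,3)
proof (induction F rule: finite_induct)
  case empty
  \<comment> \<open>\<open>S\<close> is arbitrary here, so \<open>x\<close> may fail to be
    extensional; \<open>x \<and> (x \<longrightarrow> x)\<close> is its restriction to
    \<open>{1..n}\<close>.\<close>
  have "(\<lambda>i\<in>{1..n}. s12_op (x i) (x i) (x i)) \<in> Cl_S12 n S"
    by (rule Cl_S12.step[OF assms(2) assms(2) assms(2)])
  moreover have "(\<lambda>i\<in>{1..n}. s12_op (x i) (x i) (x i)) = (\<lambda>i\<in>{1..n}. x i \<and> (\<forall>j\<in>{}. g j i))"
    by (rule restrict_ext) (simp add: s12_op_def)
  ultimately show ?case by (rule back_subst[of "\<lambda>u. u \<in> Cl_S12 n S"])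
next
  case (insert a F)
  let ?m = "\<lambda>i\<in>{1..n}. x i \<and> (\<forall>j\<in>F. g j i)"
  have m: "?m \<in> Cl_S12 n S" using insert by blast
  have "(\<lambda>i\<in>{1..n}. s12_op (?m i) (?m i) (g a i)) \<in> Cl_S12 n S"
    using insert.prems by (rule Cl_S12.step[OF m m]) simp
  moreover have "(\<lambda>i\<in>{1..n}. s12_op (?m i) (?m i) (g a i))
      = (\<lambda>i\<in>{1..n}. x i \<and> (\<forall>j\<in>insert a F. g j i))"
    by (rule restrict_ext) (auto simp: s12_op_def)
  ultimately show ?case by (rule back_subst[of "\<lambda>u. u \<in> Cl_S12 n S"])
qed

text \<open>Each coordinate is killed by some member of \<open>S\<close>, and the meet of these
  vanishes everywhere. For \<open>n = 0\<close> that family is empty, and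
  \<open>S \<noteq> {}\<close> supplies the starting vector.\<close>

lemma Cl_S12_zero:
  assumes "S \<noteq> {}" and "\<forall>i\<in>{1..n}. \<exists>w\<in>S. \<not> w i"
  shows "(\<lambda>i\<in>{1..n}. False) \<in> Cl_S12 n S"
proof -
  obtain x where x: "x \<in> S" using assms(1) by blast
  obtain g where g: "\<And>i. i \<in> {1..n} \<Longrightarrow> g i \<in> S \<and> \<not> g i i"
    using assms(2) by metis
  have "(\<lambda>i\<in>{1..n}. x i \<and> (\<forall>j\<in>{1..n}. g j i)) \<in> Cl_S12 n S"
    by (rule Cl_S12_meet) (use x g in \<open>auto intro: Cl_S12.base\<close>)
  moreover have "(\<lambda>i\<in>{1..n}. x i \<and> (\<forall>j\<in>{1..n}. g j i)) = (\<lambda>i\<in>{1..n}. False)"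
    using g by (intro restrict_ext) blast
  ultimately show ?thesis by (rule back_subst[of "\<lambda>u. u \<in> Cl_S12 n S"])
qed

lemma Cl_S12_diff:
  assumes zero: "(\<lambda>i\<in>{1..n}. False) \<in> Cl_S12 n S"
    and "x \<in> Cl_S12 n S" and "y \<in> Cl_S12 n S"
  shows "(\<lambda>i\<in>{1..n}. x i \<and> \<not> y i) \<in> Cl_S12 n S"
proof -
  have "(\<lambda>i\<in>{1..n}. s12_op (x i) (y i) ((\<lambda>i\<in>{1..n}. False) i)) \<in> Cl_S12 n S"
    by (rule Cl_S12.step[OF assms(2,3,1)])
  moreover have "(\<lambda>i\<in>{1..n}. s12_op (x i) (y i) ((\<lambda>i\<in>{1..n}. False) i))
      = (\<lambda>i\<in>{1..n}. x i \<and> \<not> y i)"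
    by (rule restrict_ext) (auto simp: s12_op_def)
  ultimately show ?thesis by (rule back_subst[of "\<lambda>u. u \<in> Cl_S12 n S"])
qed

text \<open>Each \<open>k\<close> can be treated alone, since a meet keeps the common 1 at
  \<open>i\<close> and collects the zeros. Starting the meet from \<open>p\<close> covers empty
  \<open>K\<close>.\<close>

lemma Cl_S12_separating_vector:
  assumes zero: "(\<lambda>i\<in>{1..n}. False) \<in> Cl_S12 n S"
    and p: "p \<in> S" "p i" and i: "i \<in> {1..n}" and K: "K \<subseteq> {1..n}"
    and sep: "\<And>k. k \<in> K \<Longrightarrow> \<exists>w\<in>S. w k \<noteq> w i"
  shows "\<exists>y\<in>Cl_S12 n S. y i \<and> (\<forall>k\<in>K. \<not> y k)"
proof -
  have "\<exists>c\<in>Cl_S12 n S. c i \<and> \<not> c k" if k: "k \<in> K" for k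
  proof -
    obtain w where w: "w \<in> S" "w k \<noteq> w i" using sep k by blast
    show ?thesis
    proof (cases "w i")
      case True
      then show ?thesis using w by (auto intro: Cl_S12.base)
    next
      case False
      \<comment> \<open>Now \<open>w\<close> is 1 at \<open>k\<close> and 0 at \<open>i\<close>, the
        wrong way round; subtracting it from \<open>p\<close> reverses this because
        \<open>p i\<close> holds.\<close>
      have "(\<lambda>j\<in>{1..n}. p j \<and> \<not> w j) \<in> Cl_S12 n S"
        using zero p w by (intro Cl_S12_diff[OF zero] Cl_S12.base)
      moreover have "(\<lambda>j\<in>{1..n}. p j \<and> \<not> w j) i" "\<not> (\<lambda>j\<in>{1..n}. p j \<and> \<not> w j) k"
        using False w p i k K by auto
      ultimately show ?thesis by blast
    qed
  qed
  then obtain c where c: "\<And>k. k \<in> K \<Longrightarrow> c k \<in> Cl_S12 n S \<and> c k i \<and> \<not> c k k"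
    by metis
  let ?y = "\<lambda>j\<in>{1..n}. p j \<and> (\<forall>k\<in>K. c k j)"
  have "?y \<in> Cl_S12 n S"
    by (rule Cl_S12_meet) (use finite_subset[OF K] p c in \<open>auto intro: Cl_S12.base\<close>)
  moreover have "?y i" using p i c by simp
  moreover have "\<forall>k\<in>K. \<not> ?y k" using K c by auto
  ultimately show ?thesis by blast
qed

theorem theorem4:
  fixes n :: nat and S :: "(nat \<Rightarrow> bool) set" and v :: "nat \<Rightarrow> bool"
  assumes "S \<subseteq> bvecs n"
    and "\<forall>i\<in>{1..n}. \<exists>u\<in>S. \<exists>w\<in>S. u i = True \<and> w i = False"
    and "v \<in> bvecs n"
  shows "v \<in> Cl_S12 n S \<longleftrightarrow>
    (\<exists>w\<in>S. ones n v \<subseteq> ones n w) \<and>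
    (\<forall>(k, i) \<in> ones n v \<times> zeros n v.
       \<exists>w\<in>S. (w k, w i) = (False, True) \<or> (w k, w i) = (True, False))"
    (is "_ \<longleftrightarrow> ?below \<and> ?sep")
proof
  assume v: "v \<in> Cl_S12 n S"
  obtain u where "u \<in> S" "\<forall>i\<in>{1..n}. v i \<longrightarrow> u i"
    using Cl_S12_below[OF v] by blast
  then have ?below
    by (intro bexI[of _ u]) (auto simp: ones_def)
  moreover have ?sep
  proof clarify
    fix k i assume "k \<in> ones n v" "i \<in> zeros n v"
    then have "\<exists>w\<in>S. w k \<noteq> w i"
      by (intro Cl_S12_separates[OF v]) (auto simp: ones_def zeros_def)
    then show "\<exists>w\<in>S. (w k, w i) = (False, True) \<or> (w k, w i) = (True, False)"
      by auto
  qed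
  ultimately show "?below \<and> ?sep" by blast
next
  assume *: "?below \<and> ?sep"
  then obtain w where w: "w \<in> S" "ones n v \<subseteq> ones n w" by blast
  have zero: "(\<lambda>i\<in>{1..n}. False) \<in> Cl_S12 n S"
    using w(1) assms(2) by (intro Cl_S12_zero) auto
  have "\<exists>y\<in>Cl_S12 n S. y i \<and> (\<forall>k\<in>ones n v. \<not> y k)" if i: "i \<in> zeros n v" for i
  proof -
    have i': "i \<in> {1..n}" using i by (simp add: zeros_def)
    then obtain p where p: "p \<in> S" "p i" using assms(2) by blast
    show ?thesis
    proof (rule Cl_S12_separating_vector[OF zero p i'])
      show "ones n v \<subseteq> {1..n}" by (auto simp: ones_def)
      show "\<exists>w\<in>S. w k \<noteq> w i" if k: "k \<in> ones n v" for k
      proof -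
        obtain u where "u \<in> S" "(u k, u i) = (False, True) \<or> (u k, u i) = (True, False)"
          using bspec[OF conjunct2[OF *] SigmaI[OF k i]] by blast
        then show ?thesis by (intro bexI[of _ u]) auto
      qed
    qed
  qed
  then obtain y where y: "\<And>i. i \<in> zeros n v \<Longrightarrow>
      y i \<in> Cl_S12 n S \<and> y i i \<and> (\<forall>k\<in>ones n v. \<not> y i k)"
    by metis
  \<comment> \<open>For a zero \<open>i\<close> of \<open>v\<close>, \<open>?g i\<close> is 0 at
    \<open>i\<close> and agrees with \<open>w\<close>, hence is 1, on the ones of
    \<open>v\<close>.\<close>
  let ?g = "\<lambda>i. \<lambda>j\<in>{1..n}. w j \<and> \<not> y i j"
  have "(\<lambda>j\<in>{1..n}. w j \<and> (\<forall>i\<in>zeros n v. ?g i j)) \<in> Cl_S12 n S"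
  proof (rule Cl_S12_meet)
    show "finite (zeros n v)" by (simp add: zeros_def)
    show w': "w \<in> Cl_S12 n S" using w(1) by (rule Cl_S12.base)
    show "?g i \<in> Cl_S12 n S" if "i \<in> zeros n v" for i
      using y[OF that] by (intro Cl_S12_diff[OF zero w']) simp
  qed
  moreover have "(\<lambda>j\<in>{1..n}. w j \<and> (\<forall>i\<in>zeros n v. ?g i j)) = v"
  proof (rule extensionalityI[where A = "{1..n}"])
    show "v \<in> extensional {1..n}"
      using assms(3) by (auto simp: bvecs_def PiE_def)
    show "(\<lambda>j\<in>{1..n}. w j \<and> (\<forall>i\<in>zeros n v. ?g i j)) j = v j" if j: "j \<in> {1..n}" for j
    proof (cases "v j")
      case True
      then have "j \<in> ones n v" using j by (simp add: ones_def)
      moreover from this have "w j" using w by (auto simp: ones_def)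
      ultimately show ?thesis using True j y by simp
    next
      case False
      then have "j \<in> zeros n v" using j by (simp add: zeros_def)
      \<comment> \<open>The factor \<open>?g j\<close> already vanishes at \<open>j\<close>, because
        \<open>y j j\<close> holds.\<close>
      then show ?thesis using False j y by auto
    qed
  qed simp
  ultimately show "v \<in> Cl_S12 n S" by (rule back_subst[of "\<lambda>u. u \<in> Cl_S12 n S"])
qed

end
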